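(* For every formula $\varphi$ of intuitionistic propositional logic, $\varphi$ is algebraically valid (true in every algebraic model) if and only if $\varphi$ is Kripke valid (true at every world of every Kripke model).
   Context: Formulas: built from a countable set of propositional variables indexed by natural numbers ($Var=\{p_n : n\in\mathbb{N}\}$) and $\bot$ by the binary connectives $\wedge,\vee,\to$. Kripke semantics: a Kripke model is $M=(W,R,V)$ with $W$ a non-empty set, $R$ a reflexive and transitive binary relation on $W$, and $V:Var\times W\to\{0,1\}$ such that $V(p,w)=1$ and $Rww'$ imply $V(p,w')=1$. Truth at a world: $M,w\vDash p$ iff $V(p,w)=1$; $M,w\not\vDash\bot$; $M,w\vDash\varphi\wedge\psi$ iff both hold at $w$; $M,w\vDash\varphi\vee\psi$ iff at least one holds at $w$; $M,w\vDash\varphi\to\psi$ iff for all $w'$ with $Rww'$ and $M,w'\vDash\varphi$ one has $M,w'\vDash\psi$. $\varphi$ is Kripke valid if $M,w\vDash\varphi$ for all Kripke models $M$ and all worlds $w$ of $M$. Algebraic semantics: a Heyting algebra $H$ is a bounded lattice (least element $0$, greatest element $1$) with an operation $\to$ such that $a\le b\to c$ iff $a\wedge b\le c$. An algebraic interpretation in $H$ is a function $I$ from formulas to $H$ with $I(\bot)=0$, $I(\varphi\wedge\psi)=I(\varphi)\wedge I(\psi)$, $I(\varphi\vee\psi)=I(\varphi)\vee I(\psi)$, $I(\varphi\to\psi)=I(\varphi)\to I(\psi)$. $\varphi$ is algebraically valid if $I(\varphi)=1$ for every Heyting algebra $H$ and every algebraic interpretation $I$ in $H$. *)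

theory Defs
  imports "HOL-Algebra.Lattice"
begin

datatype fm =
    Var nat
  | Fls
  | Conj fm fm
  | Disj fm fm
  | Imp fm fm

record 'w kripke =
  worlds :: "'w set"
  acc :: "('w \<times> 'w) set"
  val :: "nat \<Rightarrow> 'w \<Rightarrow> bool"

definition kripke_model :: "'w kripke \<Rightarrow> bool" where
  "kripke_model M \<longleftrightarrow>
     worlds M \<noteq> {} \<and>
     acc M \<subseteq> worlds M \<times> worlds M \<and>
     refl_on (worlds M) (acc M) \<and>
     trans (acc M) \<and>
     (\<forall>n w w'. val M n w \<and> (w, w') \<in> acc M \<longrightarrow> val M n w')"

primrec forces :: "'w kripke \<Rightarrow> 'w \<Rightarrow> fm \<Rightarrow> bool" where
  "forces M w (Var n) \<longleftrightarrow> val M n w"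
| "forces M w Fls \<longleftrightarrow> False"
| "forces M w (Conj A B) \<longleftrightarrow> forces M w A \<and> forces M w B"
| "forces M w (Disj A B) \<longleftrightarrow> forces M w A \<or> forces M w B"
| "forces M w (Imp A B) \<longleftrightarrow> (\<forall>w'. (w, w') \<in> acc M \<and> forces M w' A \<longrightarrow> forces M w' B)"

text \<open>
  HOL cannot quantify over types inside a formula. The two notions of validity below therefore
  carry the type of worlds or of algebra elements as a parameter, and range over all structures
  whose carrier is an arbitrary (non-empty) subset of that type. Every structure is isomorphic to one carried by a subset of an infinite
  type, so a statement schematic in all infinite parameter types speaks about all structures;
  over a finite type, bounded cardinality would validate more formulas.
\<close>

definition kripke_valid :: "'w itself \<Rightarrow> fm \<Rightarrow> bool" where
  "kripke_valid _ A \<longleftrightarrow>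
     (\<forall>M :: 'w kripke. kripke_model M \<longrightarrow> (\<forall>w \<in> worlds M. forces M w A))"

record 'a heyting = "'a gorder" +
  himp :: "'a \<Rightarrow> 'a \<Rightarrow> 'a" (infixr \<open>\<rightarrow>\<^sub>h\<index>\<close> 60)

locale heyting_algebra = bounded_lattice H for H (structure) +
  assumes himp_closed:
      "\<lbrakk>x \<in> carrier H; y \<in> carrier H\<rbrakk> \<Longrightarrow> x \<rightarrow>\<^sub>h y \<in> carrier H"
    and himp_residual:
      "\<lbrakk>a \<in> carrier H; b \<in> carrier H; c \<in> carrier H\<rbrakk> \<Longrightarrow>
         a \<sqsubseteq> (b \<rightarrow>\<^sub>h c) \<longleftrightarrow> (a \<sqinter> b) \<sqsubseteq> c"

definition interpretation_in :: "'a heyting \<Rightarrow> (fm \<Rightarrow> 'a) \<Rightarrow> bool" where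
  "interpretation_in H I \<longleftrightarrow>
     (\<forall>A. I A \<in> carrier H) \<and>
     I Fls = \<bottom>\<^bsub>H\<^esub> \<and>
     (\<forall>A B. I (Conj A B) = I A \<sqinter>\<^bsub>H\<^esub> I B) \<and>
     (\<forall>A B. I (Disj A B) = I A \<squnion>\<^bsub>H\<^esub> I B) \<and>
     (\<forall>A B. I (Imp A B) = I A \<rightarrow>\<^sub>h\<^bsub>H\<^esub> I B)"

definition alg_valid :: "'a itself \<Rightarrow> fm \<Rightarrow> bool" where
  "alg_valid _ A \<longleftrightarrow>
     (\<forall>(H :: 'a heyting) I. heyting_algebra H \<and> interpretation_in H I \<longrightarrow> I A = \<top>\<^bsub>H\<^esub>)"

end

(* Both directions pass through a finite countermodel whose worlds are sets of subformulas of A, so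
   that the cardinalities of the two parameter types play no role. From a Kripke countermodel take
   the sets of subformulas true at its worlds; from an algebraic countermodel take the prime
   theories of subformulas. In either case the family satisfies the clauses of the forcing relation
   under inclusion. The finite Kripke model so obtained embeds into any infinite type, and so does
   the finite Heyting algebra of its up-sets. *)
theory Submission
  imports Defs
begin

section \<open>Subformulas and saturated families\<close>

primrec subfms :: "fm \<Rightarrow> fm set" where
  "subfms (Var n) = {Var n}"
| "subfms Fls = {Fls}"
| "subfms (Conj A B) = insert (Conj A B) (subfms A \<union> subfms B)"
| "subfms (Disj A B) = insert (Disj A B) (subfms A \<union> subfms B)"
| "subfms (Imp A B) = insert (Imp A B) (subfms A \<union> subfms B)"

definition subfm_closed :: "fm set \<Rightarrow> bool" where
  "subfm_closed S \<longleftrightarrow> (\<forall>A \<in> S. subfms A \<subseteq> S)"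

lemma finite_subfms: "finite (subfms A)"
  by (induction A) auto

lemma subfms_refl [simp]: "A \<in> subfms A"
  by (cases A) auto

lemma subfm_closed_subfms: "subfm_closed (subfms A)"
  unfolding subfm_closed_def by (induction A) auto

lemma subfm_closedD:
  assumes "subfm_closed S"
  shows "Conj B C \<in> S \<Longrightarrow> B \<in> S \<and> C \<in> S"
    and "Disj B C \<in> S \<Longrightarrow> B \<in> S \<and> C \<in> S"
    and "Imp B C \<in> S \<Longrightarrow> B \<in> S \<and> C \<in> S"
  using assms unfolding subfm_closed_def by fastforce+

text \<open>These are the forcing clauses read with \<open>\<in>\<close> for truth and inclusion for
  accessibility, limited to formulas of \<open>S\<close>. The clause for \<open>Imp\<close>
  quantifies over \<open>P\<close>, so saturation is a property of the whole family and not of each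
  member alone.\<close>

definition saturated :: "fm set \<Rightarrow> fm set set \<Rightarrow> bool" where
  "saturated S P \<longleftrightarrow> P \<subseteq> Pow S \<and> (\<forall>\<Gamma> \<in> P.
     Fls \<notin> \<Gamma> \<and>
     (\<forall>B C. Conj B C \<in> S \<longrightarrow> (Conj B C \<in> \<Gamma> \<longleftrightarrow> B \<in> \<Gamma> \<and> C \<in> \<Gamma>)) \<and>
     (\<forall>B C. Disj B C \<in> S \<longrightarrow> (Disj B C \<in> \<Gamma> \<longleftrightarrow> B \<in> \<Gamma> \<or> C \<in> \<Gamma>)) \<and>
     (\<forall>B C. Imp B C \<in> S \<longrightarrow>
       (Imp B C \<in> \<Gamma> \<longleftrightarrow> (\<forall>\<Delta> \<in> P. \<Gamma> \<subseteq> \<Delta> \<and> B \<in> \<Delta> \<longrightarrow> C \<in> \<Delta>))))"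

definition inclusion_model :: "fm set set \<Rightarrow> fm set kripke" where
  "inclusion_model P = \<lparr>worlds = P, acc = {(\<Gamma>, \<Delta>). \<Gamma> \<in> P \<and> \<Delta> \<in> P \<and> \<Gamma> \<subseteq> \<Delta>},
     val = \<lambda>n \<Gamma>. Var n \<in> \<Gamma>\<rparr>"

lemma worlds_inclusion_model [simp]: "worlds (inclusion_model P) = P"
  by (simp add: inclusion_model_def)

lemma kripke_model_inclusion_model:
  assumes "P \<noteq> {}"
  shows "kripke_model (inclusion_model P)"
  using assms by (auto simp: kripke_model_def inclusion_model_def refl_on_def trans_def)

text \<open>The truth lemma: each clause of \<open>saturated\<close> matches one clause of
  \<open>forces\<close>, and closure of \<open>S\<close> under subformulas makes the induction
  hypotheses applicable. \<Gamma> is generalized because implication looks at other worlds.\<close>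

lemma forces_inclusion_model:
  assumes "subfm_closed S" "saturated S P" "\<Gamma> \<in> P" "B \<in> S"
  shows "forces (inclusion_model P) \<Gamma> B \<longleftrightarrow> B \<in> \<Gamma>"
  using assms(3,4)
proof (induction B arbitrary: \<Gamma>)
  case (Var n)
  then show ?case by (simp add: inclusion_model_def)
next
  case Fls
  then show ?case using assms(2) by (simp add: saturated_def)
next
  case (Conj B C)
  then show ?case
    using assms(2) subfm_closedD(1)[OF assms(1) Conj.prems(2)] by (simp add: saturated_def)
next
  case (Disj B C)
  then show ?case
    using assms(2) subfm_closedD(2)[OF assms(1) Disj.prems(2)] by (simp add: saturated_def)
next
  case (Imp B C)
  have "B \<in> S" "C \<in> S"
    using subfm_closedD(3)[OF assms(1) Imp.prems(2)] by auto
  with Imp.IH have "forces (inclusion_model P) \<Gamma> (Imp B C) \<longleftrightarrow>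
      (\<forall>\<Delta> \<in> P. \<Gamma> \<subseteq> \<Delta> \<and> B \<in> \<Delta> \<longrightarrow> C \<in> \<Delta>)"
    using Imp.prems(1) by (auto simp: inclusion_model_def)
  also have "\<dots> \<longleftrightarrow> Imp B C \<in> \<Gamma>"
    using assms(2) Imp.prems by (simp add: saturated_def)
  finally show ?case .
qed

section \<open>Saturated families from countermodels\<close>

text \<open>Persistence: the model condition on \<open>val\<close> settles variables, and
  transitivity of \<open>acc\<close> settles implications.\<close>

lemma forces_mono:
  assumes "kripke_model M" "(w, w') \<in> acc M" "forces M w A"
  shows "forces M w' A"
  using assms(2,3)
proof (induction A)
  case (Imp A B)
  have "(w, v) \<in> acc M" if "(w', v) \<in> acc M" for v
    using assms(1) Imp.prems(1) that unfolding kripke_model_def by (meson transD)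
  then show ?case using Imp.prems by auto
qed (use assms(1) in \<open>auto simp: kripke_model_def\<close>)

text \<open>A filtration through \<open>S\<close>. Only implication needs care, since inclusion of
  theories may relate more worlds than \<open>acc\<close> does. Inclusion still carries
  \<open>Imp B C\<close> itself into the larger theory, where reflexivity applies it; conversely, by
  persistence, accessible worlds have larger theories.\<close>

lemma saturated_forced:
  assumes M: "kripke_model M" and S: "subfm_closed S"
  shows "saturated S ((\<lambda>w. {B \<in> S. forces M w B}) ` worlds M)"
    (is "saturated S (?T ` _)")
proof -
  have imp: "Imp B C \<in> ?T w \<longleftrightarrow>
      (\<forall>\<Delta> \<in> ?T ` worlds M. ?T w \<subseteq> \<Delta> \<and> B \<in> \<Delta> \<longrightarrow> C \<in> \<Delta>)"
    if w: "w \<in> worlds M" and BC: "Imp B C \<in> S" for w B C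
  proof
    assume L: "Imp B C \<in> ?T w"
    show "\<forall>\<Delta> \<in> ?T ` worlds M. ?T w \<subseteq> \<Delta> \<and> B \<in> \<Delta> \<longrightarrow> C \<in> \<Delta>"
    proof clarify
      fix v assume v: "v \<in> worlds M" "?T w \<subseteq> ?T v" "B \<in> S" "forces M v B"
      then have "forces M v (Imp B C)" using L by blast
      moreover have "(v, v) \<in> acc M"
        using M v(1) by (auto simp: kripke_model_def refl_on_def)
      ultimately show "C \<in> S \<and> forces M v C"
        using v(4) subfm_closedD(3)[OF S BC] by auto
    qed
  next
    assume R: "\<forall>\<Delta> \<in> ?T ` worlds M. ?T w \<subseteq> \<Delta> \<and> B \<in> \<Delta> \<longrightarrow> C \<in> \<Delta>"
    have "forces M v C" if v: "(w, v) \<in> acc M" "forces M v B" for v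
    proof -
      have "v \<in> worlds M" using M v(1) by (auto simp: kripke_model_def)
      moreover have "?T w \<subseteq> ?T v" using forces_mono[OF M v(1)] by auto
      ultimately show ?thesis using R v(2) subfm_closedD(3)[OF S BC] by blast
    qed
    then show "Imp B C \<in> ?T w" using BC by auto
  qed
  have conj: "Conj B C \<in> ?T w \<longleftrightarrow> B \<in> ?T w \<and> C \<in> ?T w" if "Conj B C \<in> S" for w B C
    using subfm_closedD(1)[OF S that] that by auto
  have disj: "Disj B C \<in> ?T w \<longleftrightarrow> B \<in> ?T w \<or> C \<in> ?T w" if "Disj B C \<in> S" for w B C
    using subfm_closedD(2)[OF S that] that by auto
  show ?thesis
    unfolding saturated_def
  proof (intro conjI ballI allI impI; (elim imageE)?)
    show "?T ` worlds M \<subseteq> Pow S" by blast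
  qed (use conj disj imp in \<open>simp_all only:\<close>, simp)
qed

section \<open>Prime theories of an interpretation in a Heyting algebra\<close>

context heyting_algebra
begin

lemma himp_intro:
  assumes "a \<in> carrier H" "b \<in> carrier H" "c \<in> carrier H" "a \<sqinter> b \<sqsubseteq> c"
  shows "a \<sqsubseteq> b \<rightarrow>\<^sub>h c"
  using assms(4) himp_residual[OF assms(1-3)] by simp

lemma himp_mp:
  assumes "l \<in> carrier H" "b \<in> carrier H" "c \<in> carrier H" "l \<sqsubseteq> b \<rightarrow>\<^sub>h c" "l \<sqsubseteq> b"
  shows "l \<sqsubseteq> c"
proof -
  have "l \<sqsubseteq> l \<sqinter> b" by (rule meet_le) (simp_all add: assms)
  moreover have "l \<sqinter> b \<sqsubseteq> c" using assms(4) himp_residual[OF assms(1-3)] by simp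
  ultimately show ?thesis by (rule le_trans) (simp_all add: assms)
qed

end

locale heyting_interpretation = heyting_algebra H for H :: "'a heyting" (structure) +
  fixes I :: "fm \<Rightarrow> 'a"
  assumes interp: "interpretation_in H I"
begin

lemma interp_closed: "I B \<in> carrier H"
  using interp by (simp add: interpretation_in_def)

lemma interp_simps:
  shows "I Fls = \<bottom>" and "I (Conj B C) = I B \<sqinter> I C" and "I (Disj B C) = I B \<squnion> I C"
    and "I (Imp B C) = I B \<rightarrow>\<^sub>h I C"
  using interp by (simp_all add: interpretation_in_def)

text \<open>\<open>entails \<Gamma> x\<close> says that the meet of \<open>I ` \<Gamma>\<close> lies below \<open>x\<close>, without forming the meet.\<close>

definition entails :: "fm set \<Rightarrow> 'a \<Rightarrow> bool" where
  "entails \<Gamma> x \<longleftrightarrow> (\<forall>l \<in> carrier H. (\<forall>B \<in> \<Gamma>. l \<sqsubseteq> I B) \<longrightarrow> l \<sqsubseteq> x)"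

text \<open>A syntactic counterpart of prime filters: closed under consequence, consistent and
  prime. Closure is asked for members of \<open>S\<close> only, so a finite \<open>S\<close> has
  finitely many such theories.\<close>

definition prime_theories :: "fm set \<Rightarrow> fm set set" where
  "prime_theories S = {\<Gamma> \<in> Pow S. (\<forall>B \<in> S. entails \<Gamma> (I B) \<longrightarrow> B \<in> \<Gamma>) \<and>
     \<not> entails \<Gamma> \<bottom> \<and> (\<forall>B C. Disj B C \<in> \<Gamma> \<longrightarrow> B \<in> \<Gamma> \<or> C \<in> \<Gamma>)}"

lemma entails_member: "B \<in> \<Gamma> \<Longrightarrow> entails \<Gamma> (I B)"
  by (simp add: entails_def)

lemma entails_cut:
  "\<lbrakk>entails \<Gamma> (I B); entails (insert B \<Gamma>) x\<rbrakk> \<Longrightarrow> entails \<Gamma> x"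
  by (simp add: entails_def)

text \<open>The deduction theorem, by residuation: if \<open>l\<close> is a lower bound for
  \<Gamma>, then \<open>l \<sqinter> I B\<close> is one for
  \<open>insert B \<Gamma>\<close>.\<close>

lemma entails_insert:
  assumes x: "x \<in> carrier H"
    and ent: "entails (insert B \<Gamma>) x"
  shows "entails \<Gamma> (I B \<rightarrow>\<^sub>h x)"
  unfolding entails_def
proof (intro ballI impI)
  fix l assume l: "l \<in> carrier H" "\<forall>B \<in> \<Gamma>. l \<sqsubseteq> I B"
  have "l \<sqinter> I B \<sqsubseteq> I C" if "C \<in> insert B \<Gamma>" for C
  proof (cases "C = B")
    case True
    then show ?thesis using l(1) interp_closed by (simp add: meet_right)
  next
    case False
    with that have "C \<in> \<Gamma>" by simp
    then have "l \<sqsubseteq> I C" by (rule bspec[OF l(2)])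
    from le_trans[OF meet_left this] show ?thesis
      by (simp add: l(1) interp_closed)
  qed
  then have "l \<sqinter> I B \<sqsubseteq> x"
    using ent meet_closed[OF l(1) interp_closed] unfolding entails_def by simp
  then show "l \<sqsubseteq> I B \<rightarrow>\<^sub>h x" by (rule himp_intro[OF l(1) interp_closed x])
qed

text \<open>Proof by cases inside the algebra, with residuation in place of distributivity. For a
  lower bound \<open>l\<close>, both \<open>I B\<close> and \<open>I C\<close> lie below
  \<open>l \<rightarrow>\<^sub>h x\<close>, hence so does their join, hence so does
  \<open>l\<close>; modus ponens of \<open>l\<close> with itself gives
  \<open>l \<sqsubseteq> x\<close>.\<close>

lemma entails_prime:
  assumes x: "x \<in> carrier H" and D: "Disj B C \<in> \<Gamma>"
    and eB: "entails (insert B \<Gamma>) x" and eC: "entails (insert C \<Gamma>) x"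
  shows "entails \<Gamma> x"
  unfolding entails_def
proof (intro ballI impI)
  fix l assume l: "l \<in> carrier H" "\<forall>B \<in> \<Gamma>. l \<sqsubseteq> I B"
  have sw: "I E \<sqsubseteq> l \<rightarrow>\<^sub>h x" if "entails (insert E \<Gamma>) x" for E
  proof -
    have "l \<sqsubseteq> I E \<rightarrow>\<^sub>h x" using entails_insert[OF x that] l by (simp add: entails_def)
    then have "l \<sqinter> I E \<sqsubseteq> x" using himp_residual[OF l(1) interp_closed x] by simp
    then have "I E \<sqinter> l \<sqsubseteq> x" by (simp add: meet_comm)
    then show ?thesis by (rule himp_intro[OF interp_closed l(1) x])
  qed
  have "I B \<squnion> I C \<sqsubseteq> l \<rightarrow>\<^sub>h x"
    using sw[OF eB] sw[OF eC] by (rule join_le) (simp_all add: l(1) x interp_closed himp_closed)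
  moreover have "l \<sqsubseteq> I B \<squnion> I C" using bspec[OF l(2) D] by (simp add: interp_simps)
  ultimately have "l \<sqsubseteq> l \<rightarrow>\<^sub>h x"
    by (elim le_trans[rotated]) (simp_all add: l(1) x interp_closed himp_closed)
  then show "l \<sqsubseteq> x" by (rule himp_mp[OF l(1) l(1) x _ le_refl[OF l(1)]])
qed

text \<open>The prime filter theorem relative to \<open>S\<close>; as \<open>S\<close> is finite, a
  maximal set not entailing \<open>x\<close> exists without Zorn's lemma.\<close>

lemma prime_theory_extension:
  assumes S: "finite S" "subfm_closed S"
    and x: "x \<in> carrier H" and \<Gamma>: "\<Gamma> \<subseteq> S" "\<not> entails \<Gamma> x"
  obtains \<Delta> where "\<Delta> \<in> prime_theories S" "\<Gamma> \<subseteq> \<Delta>" "\<not> entails \<Delta> x"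
proof -
  let ?F = "{\<Delta>. \<Delta> \<subseteq> S \<and> \<not> entails \<Delta> x}"
  have "finite ?F" using S(1) by (auto intro: finite_subset[of _ "Pow S"])
  then obtain \<Delta> where \<Delta>: "\<Delta> \<in> ?F" "\<Gamma> \<subseteq> \<Delta>" and mx: "\<forall>\<Delta>' \<in> ?F. \<Delta> \<subseteq> \<Delta>' \<longrightarrow> \<Delta> = \<Delta>'"
    using finite_has_maximal2[of ?F \<Gamma>] \<Gamma> by auto
  \<comment> \<open>Maximality in usable form: adding any missing \<open>B\<close> of
    \<open>S\<close> makes \<open>x\<close> entailed. With \<open>entails_cut\<close> this yields
    deductive closure, with \<open>entails_prime\<close> primeness.\<close>
  have mem: "B \<in> \<Delta>" if "B \<in> S" "\<not> entails (insert B \<Delta>) x" for B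
    using mx that \<Delta>(1) by blast
  have "B \<in> \<Delta>" if "B \<in> S" "entails \<Delta> (I B)" for B
    using mem[OF that(1)] entails_cut[OF that(2)] \<Delta>(1) by blast
  moreover have "\<not> entails \<Delta> \<bottom>"
  proof
    assume "entails \<Delta> \<bottom>"
    then have "entails \<Delta> x"
      unfolding entails_def using le_trans[OF _ bottom_lower[OF x] _ bottom_closed x] by simp
    with \<Delta>(1) show False by simp
  qed
  moreover have "B \<in> \<Delta> \<or> C \<in> \<Delta>" if "Disj B C \<in> \<Delta>" for B C
    using mem entails_prime[OF x that] \<Delta>(1) subfm_closedD(2)[OF S(2)] that by blast
  ultimately show ?thesis
    using that[of \<Delta>] \<Delta> by (auto simp: prime_theories_def)
qed

text \<open>Closure and primeness give the clauses for \<open>Conj\<close> and \<open>Disj\<close>.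
  For \<open>Imp\<close>, one direction is modus ponens in the larger theory, the other extends
  \<open>insert B \<Gamma>\<close> to a prime theory that omits \<open>C\<close>.\<close>

lemma saturated_prime_theories:
  assumes S: "finite S" "subfm_closed S"
  shows "saturated S (prime_theories S)"
proof -
  have "Fls \<notin> \<Gamma> \<and>
     (\<forall>B C. Conj B C \<in> S \<longrightarrow> (Conj B C \<in> \<Gamma> \<longleftrightarrow> B \<in> \<Gamma> \<and> C \<in> \<Gamma>)) \<and>
     (\<forall>B C. Disj B C \<in> S \<longrightarrow> (Disj B C \<in> \<Gamma> \<longleftrightarrow> B \<in> \<Gamma> \<or> C \<in> \<Gamma>)) \<and>
     (\<forall>B C. Imp B C \<in> S \<longrightarrow>
       (Imp B C \<in> \<Gamma> \<longleftrightarrow> (\<forall>\<Delta> \<in> prime_theories S. \<Gamma> \<subseteq> \<Delta> \<and> B \<in> \<Delta> \<longrightarrow> C \<in> \<Delta>)))"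
    if \<Gamma>: "\<Gamma> \<in> prime_theories S" for \<Gamma>
  proof (intro conjI allI impI)
    have sub: "\<Gamma> \<subseteq> S" using \<Gamma> by (simp add: prime_theories_def)
    \<comment> \<open>Closure with \<open>entails\<close> unfolded, so that membership reduces to an
      inequality for an arbitrary lower bound \<open>l\<close>. It is stated for any prime theory
      because the implication case applies it to \<Delta>.\<close>
    have cl: "B \<in> \<Gamma>" if "\<Gamma> \<in> prime_theories S" "B \<in> S"
      "\<And>l. \<lbrakk>l \<in> carrier H; \<And>C. C \<in> \<Gamma> \<Longrightarrow> l \<sqsubseteq> I C\<rbrakk> \<Longrightarrow> l \<sqsubseteq> I B" for B \<Gamma>
      using that by (simp add: prime_theories_def entails_def)
    show "Fls \<notin> \<Gamma>"
      using \<Gamma> entails_member[of Fls \<Gamma>] by (auto simp: prime_theories_def interp_simps)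
    show "Conj B C \<in> \<Gamma> \<longleftrightarrow> B \<in> \<Gamma> \<and> C \<in> \<Gamma>" if BC: "Conj B C \<in> S" for B C
    proof (intro iffI conjI)
      assume L: "Conj B C \<in> \<Gamma>"
      show "B \<in> \<Gamma>"
      proof (rule cl[OF \<Gamma>])
        fix l assume l: "l \<in> carrier H" "\<And>C. C \<in> \<Gamma> \<Longrightarrow> l \<sqsubseteq> I C"
        then have "l \<sqsubseteq> I B \<sqinter> I C" using l(2)[OF L] interp_simps by simp
        then show "l \<sqsubseteq> I B"
          by (rule le_trans[OF _ meet_left]) (simp_all add: l(1) interp_closed)
      qed (use subfm_closedD(1)[OF S(2) BC] in auto)
      show "C \<in> \<Gamma>"
      proof (rule cl[OF \<Gamma>])
        fix l assume l: "l \<in> carrier H" "\<And>C. C \<in> \<Gamma> \<Longrightarrow> l \<sqsubseteq> I C"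
        then have "l \<sqsubseteq> I B \<sqinter> I C" using l(2)[OF L] interp_simps by simp
        then show "l \<sqsubseteq> I C"
          by (rule le_trans[OF _ meet_right]) (simp_all add: l(1) interp_closed)
      qed (use subfm_closedD(1)[OF S(2) BC] in auto)
    next
      assume "B \<in> \<Gamma> \<and> C \<in> \<Gamma>"
      then show "Conj B C \<in> \<Gamma>"
        by (intro cl[OF \<Gamma> BC]) (simp add: interp_simps meet_le interp_closed)
    qed
    show "Disj B C \<in> \<Gamma> \<longleftrightarrow> B \<in> \<Gamma> \<or> C \<in> \<Gamma>" if BC: "Disj B C \<in> S" for B C
    proof
      assume "Disj B C \<in> \<Gamma>"
      then show "B \<in> \<Gamma> \<or> C \<in> \<Gamma>" using \<Gamma> by (auto simp: prime_theories_def)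
    next
      assume R: "B \<in> \<Gamma> \<or> C \<in> \<Gamma>"
      show "Disj B C \<in> \<Gamma>"
      proof (rule cl[OF \<Gamma> BC])
        fix l assume l: "l \<in> carrier H" "\<And>C. C \<in> \<Gamma> \<Longrightarrow> l \<sqsubseteq> I C"
        from R show "l \<sqsubseteq> I (Disj B C)"
          unfolding interp_simps
        proof
          assume "B \<in> \<Gamma>"
          from l(2)[OF this] show "l \<sqsubseteq> I B \<squnion> I C"
            by (rule le_trans[OF _ join_left]) (simp_all add: l(1) interp_closed)
        next
          assume "C \<in> \<Gamma>"
          from l(2)[OF this] show "l \<sqsubseteq> I B \<squnion> I C"
            by (rule le_trans[OF _ join_right]) (simp_all add: l(1) interp_closed)
        qed
      qed
    qed
    show "Imp B C \<in> \<Gamma> \<longleftrightarrow> (\<forall>\<Delta> \<in> prime_theories S. \<Gamma> \<subseteq> \<Delta> \<and> B \<in> \<Delta> \<longrightarrow> C \<in> \<Delta>)"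
      if BC: "Imp B C \<in> S" for B C
    proof
      assume L: "Imp B C \<in> \<Gamma>"
      show "\<forall>\<Delta> \<in> prime_theories S. \<Gamma> \<subseteq> \<Delta> \<and> B \<in> \<Delta> \<longrightarrow> C \<in> \<Delta>"
      proof (intro ballI impI, elim conjE)
        fix \<Delta> assume \<Delta>: "\<Delta> \<in> prime_theories S" "\<Gamma> \<subseteq> \<Delta>" "B \<in> \<Delta>"
        show "C \<in> \<Delta>"
        proof (rule cl[OF \<Delta>(1)])
          fix l assume l: "l \<in> carrier H" "\<And>C. C \<in> \<Delta> \<Longrightarrow> l \<sqsubseteq> I C"
          have "l \<sqsubseteq> I B \<rightarrow>\<^sub>h I C" using l(2)[OF subsetD[OF \<Delta>(2) L]] by (simp add: interp_simps)
          then show "l \<sqsubseteq> I C"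
            using l(2)[OF \<Delta>(3)] by (rule himp_mp[OF l(1) interp_closed interp_closed])
        qed (use subfm_closedD(3)[OF S(2) BC] in auto)
      qed
    next
      assume R: "\<forall>\<Delta> \<in> prime_theories S. \<Gamma> \<subseteq> \<Delta> \<and> B \<in> \<Delta> \<longrightarrow> C \<in> \<Delta>"
      show "Imp B C \<in> \<Gamma>"
      proof (rule ccontr)
        assume "Imp B C \<notin> \<Gamma>"
        \<comment> \<open>\<open>Imp B C\<close> lies in \<open>S\<close>, so by closure its absence
          from \<Gamma> means that it is not entailed; the deduction theorem then lets
          \<open>B\<close> be added without entailing \<open>I C\<close>.\<close>
        then have "\<not> entails \<Gamma> (I B \<rightarrow>\<^sub>h I C)"
          using \<Gamma> BC by (auto simp: prime_theories_def interp_simps)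
        then have "\<not> entails (insert B \<Gamma>) (I C)"
          using entails_insert[OF interp_closed] by blast
        moreover have "insert B \<Gamma> \<subseteq> S" using sub subfm_closedD(3)[OF S(2) BC] by auto
        ultimately obtain \<Delta> where \<Delta>: "\<Delta> \<in> prime_theories S" "insert B \<Gamma> \<subseteq> \<Delta>"
          "\<not> entails \<Delta> (I C)"
          using prime_theory_extension[OF S interp_closed] by metis
        then have "C \<in> \<Delta>" using R by auto
        then show False using \<Delta>(3) entails_member by blast
      qed
    qed
  qed
  moreover have "prime_theories S \<subseteq> Pow S" by (auto simp: prime_theories_def)
  ultimately show ?thesis unfolding saturated_def by simp
qed

text \<open>Every element, \<top> included, is a lower bound for the empty set, so the empty set
  entails only \<top> and can be extended without entailing \<open>I A\<close>.\<close>

lemma prime_theory_omitting: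
  assumes S: "finite S" "subfm_closed S" and A: "I A \<noteq> \<top>"
  obtains \<Gamma> where "\<Gamma> \<in> prime_theories S" "A \<notin> \<Gamma>"
proof -
  have "\<not> entails {} (I A)"
  proof
    assume "entails {} (I A)"
    then have "\<top> \<sqsubseteq> I A" by (simp add: entails_def)
    then show False using A interp_closed top_higher[OF interp_closed] le_antisym by auto
  qed
  then obtain \<Gamma> where "\<Gamma> \<in> prime_theories S" "\<not> entails \<Gamma> (I A)"
    using prime_theory_extension[OF S interp_closed, of "{}"] by auto
  then show ?thesis using that entails_member by blast
qed

end

section \<open>Realizing finite countermodels in infinite types\<close>

lemma finite_inj_into_infinite:
  assumes "finite X" "infinite (UNIV :: 'b set)"
  obtains f :: "'a \<Rightarrow> 'b" where "inj_on f X"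
proof -
  obtain Y :: "'b set" where "finite Y" "card Y = card X"
    using infinite_arbitrarily_large[OF assms(2)] by metis
  then obtain f where "bij_betw f X Y"
    using finite_same_card_bij[OF assms(1)] by metis
  then show ?thesis using that bij_betw_imp_inj_on by blast
qed

text \<open>Validity over one infinite type reaches finite models over any other type, through an
  isomorphic copy along an injection of the worlds.\<close>

lemma kripke_valid_finite_model:
  assumes val: "kripke_valid TYPE('w) A" and inf: "infinite (UNIV :: 'w set)"
    and M: "kripke_model (M :: 'v kripke)" and fin: "finite (worlds M)" and w: "w \<in> worlds M"
  shows "forces M w A"
proof -
  obtain f :: "'v \<Rightarrow> 'w" where f: "inj_on f (worlds M)"
    using finite_inj_into_infinite[OF fin inf] by metis
  \<comment> \<open>The copy of \<open>M\<close> along \<open>f\<close>. Off the image of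
    \<open>worlds M\<close> the inverse has an unspecified value, which is harmless because
    \<open>acc N\<close> relates only points of the image.\<close>
  define N where "N = \<lparr>worlds = f ` worlds M, acc = map_prod f f ` acc M,
    val = \<lambda>n x. val M n (inv_into (worlds M) f x)\<rparr>"
  have accM: "acc M \<subseteq> worlds M \<times> worlds M" using M by (simp add: kripke_model_def)
  have accN: "(f u, f v) \<in> acc N \<longleftrightarrow> (u, v) \<in> acc M"
    if "u \<in> worlds M" "v \<in> worlds M" for u v
  proof
    assume "(f u, f v) \<in> acc N"
    then obtain a b where ab: "(a, b) \<in> acc M" "f u = f a" "f v = f b"
      by (auto simp: N_def)
    then have "u = a" "v = b" using inj_onD[OF f] accM that by blast+
    then show "(u, v) \<in> acc M" using ab(1) by simp
  next
    assume "(u, v) \<in> acc M"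
    then show "(f u, f v) \<in> acc N" by (force simp: N_def)
  qed
  have wN: "worlds N = f ` worlds M" by (simp add: N_def)
  have accN': "acc N \<subseteq> worlds N \<times> worlds N" using accM by (auto simp: N_def)
  have valN: "val N n (f u) = val M n u" if "u \<in> worlds M" for n u
    using that f by (simp add: N_def)
  have forcesN: "forces N (f u) B \<longleftrightarrow> forces M u B" if "u \<in> worlds M" for u B
    using that
  proof (induction B arbitrary: u)
    case (Imp B C)
    have "forces N (f u) (Imp B C) \<longleftrightarrow>
        (\<forall>v \<in> worlds M. (f u, f v) \<in> acc N \<and> forces N (f v) B \<longrightarrow> forces N (f v) C)"
      using accN' wN by auto
    also have "\<dots> \<longleftrightarrow> (\<forall>v \<in> worlds M. (u, v) \<in> acc M \<and> forces M v B \<longrightarrow> forces M v C)"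
      using Imp accN by blast
    also have "\<dots> \<longleftrightarrow> forces M u (Imp B C)" using accM by auto
    finally show ?case .
  qed (simp_all add: valN)
  have "kripke_model N"
    unfolding kripke_model_def
  proof (intro conjI)
    show "worlds N \<noteq> {}" using w wN by auto
    show "acc N \<subseteq> worlds N \<times> worlds N" by (rule accN')
    show "refl_on (worlds N) (acc N)"
      using M accN wN by (auto simp: kripke_model_def refl_on_def)
    show "trans (acc N)"
    proof (rule transI)
      fix x y z assume xyz: "(x, y) \<in> acc N" "(y, z) \<in> acc N"
      then obtain u v t where xyz_eq: "x = f u" "y = f v" "z = f t"
        and uvt: "u \<in> worlds M" "v \<in> worlds M" "t \<in> worlds M"
        using accN' wN by blast
      have "(u, v) \<in> acc M" "(v, t) \<in> acc M"
        using xyz accN uvt xyz_eq by simp_all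
      moreover have "trans (acc M)" using M by (simp add: kripke_model_def)
      ultimately have "(u, t) \<in> acc M" by (meson transD)
      then show "(x, z) \<in> acc N" using accN uvt xyz_eq by simp
    qed
    show "\<forall>n w w'. val N n w \<and> (w, w') \<in> acc N \<longrightarrow> val N n w'"
    proof (intro allI impI, elim conjE)
      fix n x y assume xy: "val N n x" "(x, y) \<in> acc N"
      then obtain u v where xy_eq: "x = f u" "y = f v" and uv: "u \<in> worlds M" "v \<in> worlds M"
        using accN' wN by blast
      have "(u, v) \<in> acc M" "val M n u" using xy xy_eq uv accN valN by simp_all
      then have "val M n v" using M unfolding kripke_model_def by blast
      then show "val N n y" using uv xy_eq valN by simp
    qed
  qed
  then have "forces N (f w) A" using val w wN by (auto simp: kripke_valid_def)
  then show ?thesis using forcesN w by blast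
qed

section \<open>The Heyting algebra of up-sets of a Kripke model\<close>

definition upsets :: "'w kripke \<Rightarrow> 'w set set" where
  "upsets M = {U. U \<subseteq> worlds M \<and> (\<forall>w w'. w \<in> U \<and> (w, w') \<in> acc M \<longrightarrow> w' \<in> U)}"

text \<open>The forcing clause of implication on sets of worlds; in a Kripke model it is the largest
  up-set whose intersection with \<open>U\<close> lies in \<open>V\<close>.\<close>

definition upset_imp :: "'w kripke \<Rightarrow> 'w set \<Rightarrow> 'w set \<Rightarrow> 'w set" where
  "upset_imp M U V = {w \<in> worlds M. \<forall>w'. (w, w') \<in> acc M \<and> w' \<in> U \<longrightarrow> w' \<in> V}"

text \<open>The map \<open>f\<close> encodes up-sets as elements of a prescribed type
  \<open>'h\<close>; order and implication decode through its inverse. Meet, join and bounds are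
  derived from \<open>le\<close> and are identified afterwards.\<close>

definition upset_algebra :: "'w kripke \<Rightarrow> ('w set \<Rightarrow> 'h) \<Rightarrow> 'h heyting" where
  "upset_algebra M f = \<lparr>carrier = f ` upsets M, eq = (=),
     le = \<lambda>x y. inv_into (upsets M) f x \<subseteq> inv_into (upsets M) f y,
     himp = \<lambda>x y. f (upset_imp M (inv_into (upsets M) f x) (inv_into (upsets M) f y))\<rparr>"

context
  fixes M :: "'w kripke"
  assumes M: "kripke_model M"
begin

lemma upsets_closed:
  shows "{} \<in> upsets M" "worlds M \<in> upsets M"
    and "U \<in> upsets M \<Longrightarrow> V \<in> upsets M \<Longrightarrow> U \<inter> V \<in> upsets M"
    and "U \<in> upsets M \<Longrightarrow> V \<in> upsets M \<Longrightarrow> U \<union> V \<in> upsets M"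
  using M unfolding upsets_def kripke_model_def by auto

lemma upsets_bounded: "U \<in> upsets M \<Longrightarrow> U \<subseteq> worlds M"
  by (simp add: upsets_def)

lemma upset_imp_closed: "upset_imp M U V \<in> upsets M"
  using M unfolding upsets_def upset_imp_def kripke_model_def by (auto dest: transD)

text \<open>Left to right uses reflexivity of \<open>acc\<close>, right to left that
  \<open>U\<close> is closed under \<open>acc\<close>.\<close>

lemma upset_imp_residual:
  assumes "U \<in> upsets M"
  shows "U \<subseteq> upset_imp M V W \<longleftrightarrow> U \<inter> V \<subseteq> W"
  using assms M unfolding upsets_def upset_imp_def kripke_model_def refl_on_def by blast

lemma forced_in_upsets: "{w \<in> worlds M. forces M w B} \<in> upsets M"
proof -
  have "w' \<in> worlds M \<and> forces M w' B" if "forces M w B" "(w, w') \<in> acc M" for w w'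
    using forces_mono[OF M that(2,1)] that(2) M by (auto simp: kripke_model_def)
  then show ?thesis by (auto simp: upsets_def)
qed

context
  fixes f :: "'w set \<Rightarrow> 'h"
  assumes f: "inj_on f (upsets M)"
begin

abbreviation (input) "HM \<equiv> upset_algebra M f"

lemma upset_algebra_simps:
  shows carrier_upset_algebra: "carrier HM = f ` upsets M"
    and eq_upset_algebra: "(.=\<^bsub>HM\<^esub>) = (=)"
    and le_upset_algebra:
      "U \<in> upsets M \<Longrightarrow> V \<in> upsets M \<Longrightarrow> f U \<sqsubseteq>\<^bsub>HM\<^esub> f V \<longleftrightarrow> U \<subseteq> V"
    and himp_upset_algebra:
      "U \<in> upsets M \<Longrightarrow> V \<in> upsets M \<Longrightarrow> f U \<rightarrow>\<^sub>h\<^bsub>HM\<^esub> f V = f (upset_imp M U V)"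
  using f by (auto simp: upset_algebra_def)

lemma is_glb_upset_algebra:
  assumes "U \<in> upsets M" "V \<in> upsets M"
  shows "greatest HM (f (U \<inter> V)) (Lower HM {f U, f V})"
  using assms upsets_closed
  by (auto simp: greatest_def Lower_def carrier_upset_algebra le_upset_algebra)

lemma is_lub_upset_algebra:
  assumes "U \<in> upsets M" "V \<in> upsets M"
  shows "least HM (f (U \<union> V)) (Upper HM {f U, f V})"
  using assms upsets_closed
  by (auto simp: least_def Upper_def carrier_upset_algebra le_upset_algebra)

lemma partial_order_upset_algebra: "partial_order HM"
proof
  show "x .=\<^bsub>HM\<^esub> y"
    if "x \<sqsubseteq>\<^bsub>HM\<^esub> y" "y \<sqsubseteq>\<^bsub>HM\<^esub> x" "x \<in> carrier HM" "y \<in> carrier HM" for x y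
  proof -
    obtain U V where "x = f U" "y = f V" "U \<in> upsets M" "V \<in> upsets M"
      using \<open>x \<in> carrier HM\<close> \<open>y \<in> carrier HM\<close> unfolding carrier_upset_algebra by blast
    with that(1,2) show ?thesis by (simp add: le_upset_algebra eq_upset_algebra)
  qed
qed (auto simp: carrier_upset_algebra le_upset_algebra eq_upset_algebra)

lemma bounded_lattice_upset_algebra: "bounded_lattice HM"
proof -
  interpret partial_order HM by (rule partial_order_upset_algebra)
  show ?thesis
  proof
    show "\<exists>s. least HM s (Upper HM {x, y})" if "x \<in> carrier HM" "y \<in> carrier HM" for x y
      using that is_lub_upset_algebra unfolding carrier_upset_algebra by blast
    show "\<exists>s. greatest HM s (Lower HM {x, y})" if "x \<in> carrier HM" "y \<in> carrier HM" for x y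
      using that is_glb_upset_algebra unfolding carrier_upset_algebra by blast
    have "least HM (f {}) (carrier HM)"
      using upsets_closed by (simp add: least_def carrier_upset_algebra le_upset_algebra)
    then show "\<exists>x. least HM x (carrier HM)" ..
    have "greatest HM (f (worlds M)) (carrier HM)"
      using upsets_closed upsets_bounded
      by (simp add: greatest_def carrier_upset_algebra le_upset_algebra)
    then show "\<exists>x. greatest HM x (carrier HM)" ..
  qed
qed

text \<open>The lattice operations are given by choice of an extremal element, so uniqueness of such
  elements identifies them with the encoded set operations.\<close>

lemma upset_algebra_ops:
  shows meet_upset_algebra:
      "U \<in> upsets M \<Longrightarrow> V \<in> upsets M \<Longrightarrow> f U \<sqinter>\<^bsub>HM\<^esub> f V = f (U \<inter> V)"
    and join_upset_algebra:
      "U \<in> upsets M \<Longrightarrow> V \<in> upsets M \<Longrightarrow> f U \<squnion>\<^bsub>HM\<^esub> f V = f (U \<union> V)"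
    and bottom_upset_algebra: "\<bottom>\<^bsub>HM\<^esub> = f {}"
    and top_upset_algebra: "\<top>\<^bsub>HM\<^esub> = f (worlds M)"
proof -
  interpret bounded_lattice HM by (rule bounded_lattice_upset_algebra)
  show "f U \<sqinter>\<^bsub>HM\<^esub> f V = f (U \<inter> V)" if U: "U \<in> upsets M" and V: "V \<in> upsets M"
  proof (rule meetI)
    fix i assume "greatest HM i (Lower HM {f U, f V})"
    then show "i = f (U \<inter> V)" using is_glb_upset_algebra[OF U V] by (rule greatest_unique)
  qed (simp_all add: carrier_upset_algebra U V)
  show "f U \<squnion>\<^bsub>HM\<^esub> f V = f (U \<union> V)" if U: "U \<in> upsets M" and V: "V \<in> upsets M"
  proof (rule joinI)
    fix l assume "least HM l (Upper HM {f U, f V})"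
    then show "l = f (U \<union> V)" using is_lub_upset_algebra[OF U V] by (rule least_unique)
  qed (simp_all add: carrier_upset_algebra U V)
  have "f {} \<sqsubseteq>\<^bsub>HM\<^esub> x" if "x \<in> carrier HM" for x
    using that upsets_closed(1) unfolding carrier_upset_algebra
    by (elim imageE) (simp add: le_upset_algebra)
  then show "\<bottom>\<^bsub>HM\<^esub> = f {}"
    using bottom_eq[of "f {}"] upsets_closed(1) by (simp add: carrier_upset_algebra)
  have "x \<sqsubseteq>\<^bsub>HM\<^esub> f (worlds M)" if "x \<in> carrier HM" for x
    using that upsets_closed(2) upsets_bounded unfolding carrier_upset_algebra
    by (elim imageE) (simp add: le_upset_algebra)
  then show "\<top>\<^bsub>HM\<^esub> = f (worlds M)"
    using top_eq[of "f (worlds M)"] upsets_closed(2) by (simp add: carrier_upset_algebra)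
qed

lemma heyting_algebra_upset_algebra: "heyting_algebra HM"
proof -
  interpret bounded_lattice HM by (rule bounded_lattice_upset_algebra)
  show ?thesis
  proof
    show "x \<rightarrow>\<^sub>h\<^bsub>HM\<^esub> y \<in> carrier HM" if "x \<in> carrier HM" "y \<in> carrier HM" for x y
      using that upset_imp_closed unfolding carrier_upset_algebra
      by (elim imageE) (simp add: himp_upset_algebra)
    show "a \<sqsubseteq>\<^bsub>HM\<^esub> b \<rightarrow>\<^sub>h\<^bsub>HM\<^esub> c \<longleftrightarrow> a \<sqinter>\<^bsub>HM\<^esub> b \<sqsubseteq>\<^bsub>HM\<^esub> c"
      if abc: "a \<in> carrier HM" "b \<in> carrier HM" "c \<in> carrier HM" for a b c
    proof -
      obtain U V W where "a = f U" "b = f V" "c = f W"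
        and UVW: "U \<in> upsets M" "V \<in> upsets M" "W \<in> upsets M"
        using abc unfolding carrier_upset_algebra by blast
      then show ?thesis
        by (simp add: himp_upset_algebra le_upset_algebra meet_upset_algebra upset_imp_closed
            upsets_closed upset_imp_residual)
    qed
  qed
qed

lemma interpretation_in_upset_algebra:
  "interpretation_in HM (\<lambda>B. f {w \<in> worlds M. forces M w B})"
proof -
  let ?T = "\<lambda>B. {w \<in> worlds M. forces M w B}"
  have imp: "upset_imp M (?T B) (?T C) = ?T (Imp B C)" for B C
    using M by (auto simp: upset_imp_def kripke_model_def)
  have "?T (Conj B C) = ?T B \<inter> ?T C" "?T (Disj B C) = ?T B \<union> ?T C" for B C by auto
  \<comment> \<open>Truth sets of compound formulas must stay folded for the equations above to
    rewrite them, hence the deleted forcing clauses.\<close>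
  then show ?thesis
    unfolding interpretation_in_def
    using forced_in_upsets by (simp add: imp carrier_upset_algebra upset_algebra_ops himp_upset_algebra
        del: forces.simps(3-5))
qed

end

end

text \<open>A finite model has finitely many up-sets, so its algebra embeds in \<open>'h\<close>.
  There the truth set of \<open>A\<close> is sent to \<top>, the code of \<open>worlds M\<close>,
  and injectivity makes the two sets equal.\<close>

lemma alg_valid_finite_model:
  assumes val: "alg_valid TYPE('h) A" and inf: "infinite (UNIV :: 'h set)"
    and M: "kripke_model (M :: 'v kripke)" and fin: "finite (worlds M)" and w: "w \<in> worlds M"
  shows "forces M w A"
proof -
  have "upsets M \<subseteq> Pow (worlds M)" by (auto simp: upsets_def)
  then have "finite (upsets M)" using fin finite_subset by blast
  then obtain f :: "'v set \<Rightarrow> 'h" where f: "inj_on f (upsets M)"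
    using finite_inj_into_infinite[OF _ inf] by metis
  have "f {w \<in> worlds M. forces M w A} = \<top>\<^bsub>upset_algebra M f\<^esub>"
    using val[unfolded alg_valid_def, rule_format, OF conjI]
      heyting_algebra_upset_algebra[OF M f] interpretation_in_upset_algebra[OF M f] by simp
  then have "f {w \<in> worlds M. forces M w A} = f (worlds M)"
    using top_upset_algebra[OF M f] by simp
  then have "{w \<in> worlds M. forces M w A} = worlds M"
    by (rule inj_onD[OF f _ forced_in_upsets[OF M] upsets_closed(2)[OF M]])
  then show ?thesis using w by blast
qed

section \<open>Transfer of countermodels between the two semantics\<close>

theorem mainTheorem3:
  fixes A :: fm
  assumes "infinite (UNIV :: 'h set)" and "infinite (UNIV :: 'w set)"
  shows "alg_valid TYPE('h) A \<longleftrightarrow> kripke_valid TYPE('w) A"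
proof
  let ?S = "subfms A"
  note S = finite_subfms[of A] subfm_closed_subfms[of A]
  have fin: "finite P" if "saturated ?S P" for P
    using that S(1) by (auto simp: saturated_def intro: finite_subset[of _ "Pow ?S"])
  show "kripke_valid TYPE('w) A" if val: "alg_valid TYPE('h) A"
    unfolding kripke_valid_def
  proof (intro allI impI ballI)
    fix M :: "'w kripke" and w assume M: "kripke_model M" and w: "w \<in> worlds M"
    let ?T = "\<lambda>w. {B \<in> ?S. forces M w B}"
    let ?P = "?T ` worlds M"
    have sat: "saturated ?S ?P" by (rule saturated_forced[OF M S(2)])
    have "?P \<noteq> {}" "?T w \<in> ?P" using w by auto
    \<comment> \<open>The filtrated model is finite, so algebraic validity over \<open>'h\<close>
      applies to it; the truth lemma then returns the result to \<open>w\<close>.\<close>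
    then have "forces (inclusion_model ?P) (?T w) A"
      using alg_valid_finite_model[OF val assms(1) kripke_model_inclusion_model, of ?P]
        fin[OF sat] by simp
    then have "A \<in> ?T w"
      using forces_inclusion_model[OF S(2) sat \<open>?T w \<in> ?P\<close>] by simp
    then show "forces M w A" by simp
  qed
  show "alg_valid TYPE('h) A" if val: "kripke_valid TYPE('w) A"
    unfolding alg_valid_def
  proof (intro allI impI, elim conjE)
    fix H :: "'h heyting" and I assume H: "heyting_algebra H" and I: "interpretation_in H I"
    interpret heyting_interpretation H I
      using H I by (simp add: heyting_interpretation_def heyting_interpretation_axioms_def)
    let ?P = "prime_theories ?S"
    have sat: "saturated ?S ?P" by (rule saturated_prime_theories[OF S])
    show "I A = \<top>\<^bsub>H\<^esub>"
    proof (rule ccontr)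
      assume "I A \<noteq> \<top>\<^bsub>H\<^esub>"
      \<comment> \<open>This \<Gamma> is a world of a finite inclusion model: Kripke validity over
        \<open>'w\<close> forces \<open>A\<close> there, and the truth lemma would put
        \<open>A\<close> into \<Gamma>.\<close>
      then obtain \<Gamma> where \<Gamma>: "\<Gamma> \<in> ?P" "A \<notin> \<Gamma>"
        using prime_theory_omitting[OF S] by metis
      then have "?P \<noteq> {}" by auto
      then have "forces (inclusion_model ?P) \<Gamma> A"
        using kripke_valid_finite_model[OF val assms(2) kripke_model_inclusion_model, of ?P]
          fin[OF sat] \<Gamma>(1) by simp
      then show False
        using forces_inclusion_model[OF S(2) sat \<Gamma>(1)] \<Gamma>(2) by simp
    qed
  qed
qed

end
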